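(* Let $m\ge 2$, $1\le c\le m-1$ and $n\ge 1$. Then, as formal power series in $q,z$, $$\sum_{\lambda\in\mathcal{O}_{c,m}^n} z^{\ell(\lambda)}q^{|\lambda|}=\sum_{\mu\in\mathcal{L}_{c,m}^n} z^{s(\mu)}q^{|\mu|}=\frac{1}{(1-zq^c)(1-zq^{m+c})\cdots(1-zq^{(n-1)m+c})}.$$
   Context: A partition $\lambda=(\lambda_1,\lambda_2,\ldots)$ is a nonincreasing sequence of nonnegative integers with finitely many nonzero terms (zeros appended as needed); $|\lambda|=\sum_i\lambda_i$ and $l(\lambda)$ is the number of nonzero parts. For $1\le i\le m$, $s_i(\lambda)=\lambda_i-\lambda_{i+1}+\lambda_{m+i}-\lambda_{m+i+1}+\lambda_{2m+i}-\lambda_{2m+i+1}+\cdots$; $\mathbf{s}(\lambda)=(s_1(\lambda),\ldots,s_{m-1}(\lambda))$ and $s(\lambda)=\sum_{i=1}^{m-1}s_i(\lambda)$. $\ell(\lambda)$ is the number of nonzero parts of $\lambda$ not divisible by $m$. $\mathcal{D}_m$ is the set of partitions in which each nonzero part appears at most $m-1$ times. $\mathcal{O}_{c,m}^n$ is the set of partitions all of whose nonzero parts are congruent to $c$ modulo $m$ and with $\lambda_1<nm$. $\mathcal{D}_{c,m}$ is the set of $\lambda\in\mathcal{D}_m$ such that either $|\lambda|=0$ or $\mathbf{s}(\lambda)=(0,\ldots,0,a,0,\ldots,0)$ with $a>0$ in position $c$ and zeros elsewhere. $\mathcal{L}_{c,m}^n$ is the set of $\lambda\in\mathcal{D}_{c,m}$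 with $l(\lambda)\le\lfloor (n+1)/2\rfloor(m-2)+n$ and $$\frac{\lambda_{km+c}}{n-2k}\ge\frac{\lambda_{km+m}}{n-2k-1}\ge\frac{\lambda_{(k+1)m+c}}{n-2k-2}\quad\text{for all } 0\le k<\lceil n/2\rceil,$$ with the convention that a fraction $p/q$ with $q=0$ forces $p=0$. *)

theory Defs
  imports "HOL-Analysis.Infinite_Sum" "HOL-Number_Theory.Cong"
begin

text \<open>A partition is stored as a function \<open>l\<close> indexed from 0, so that \<open>l 0\<close> is the largest
  part. All the formulas below use the customary 1-based \<open>part l i\<close>, which is only meaningful for
  \<open>i \<ge> 1\<close>.\<close>

definition partitions :: "(nat \<Rightarrow> nat) set" where
  "partitions = {l. antimono l \<and> finite {i. l i \<noteq> 0}}"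

definition part :: "(nat \<Rightarrow> nat) \<Rightarrow> nat \<Rightarrow> nat" where
  "part l i = l (i - 1)"

definition psize :: "(nat \<Rightarrow> nat) \<Rightarrow> nat" where
  "psize l = (\<Sum>i | l i \<noteq> 0. l i)"

definition plength :: "(nat \<Rightarrow> nat) \<Rightarrow> nat" where
  "plength l = card {i. l i \<noteq> 0}"

text \<open>Parts are counted with multiplicity.\<close>

definition plength_nondvd :: "nat \<Rightarrow> (nat \<Rightarrow> nat) \<Rightarrow> nat" where
  "plength_nondvd m l = card {i. l i \<noteq> 0 \<and> \<not> m dvd l i}"

text \<open>The parts are nonincreasing, so the subtraction on naturals below does not truncate; for
  \<open>m \<ge> 1\<close> the series has only finitely many nonzero terms.\<close>

definition s_entry :: "nat \<Rightarrow> nat \<Rightarrow> (nat \<Rightarrow> nat) \<Rightarrow> nat" where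
  "s_entry m i l = (\<Sum>j. part l (j * m + i) - part l (j * m + i + 1))"

definition s_total :: "nat \<Rightarrow> (nat \<Rightarrow> nat) \<Rightarrow> nat" where
  "s_total m l = (\<Sum>i = 1..m - 1. s_entry m i l)"

definition D_set :: "nat \<Rightarrow> (nat \<Rightarrow> nat) set" where
  "D_set m = {l \<in> partitions. \<forall>p > 0. card {i. l i = p} \<le> m - 1}"

definition O_set :: "nat \<Rightarrow> nat \<Rightarrow> nat \<Rightarrow> (nat \<Rightarrow> nat) set" where
  "O_set c m n = {l \<in> partitions.
     (\<forall>i. l i \<noteq> 0 \<longrightarrow> [l i = c] (mod m)) \<and> part l 1 < n * m}"

definition Dc_set :: "nat \<Rightarrow> nat \<Rightarrow> (nat \<Rightarrow> nat) set" where
  "Dc_set c m = {l \<in> D_set m. psize l = 0 \<or>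
     (\<exists>a > 0. \<forall>i \<in> {1..m - 1}. s_entry m i l = (if i = c then a else 0))}"

definition fraction_convention :: "rat \<Rightarrow> rat \<Rightarrow> bool" where
  "fraction_convention p q \<longleftrightarrow> (q = 0 \<longrightarrow> p = 0)"

text \<open>Both \<open>\<lfloor>(n + 1) / 2\<rfloor>\<close> and \<open>\<lceil>n / 2\<rceil>\<close> are \<open>(n + 1) div 2\<close>. The denominators are rationals, not
  naturals: for odd \<open>n\<close> and \<open>k = (n - 1) / 2\<close> they are 1, 0 and -1. The convention then makes the
  middle numerator 0, hence also the last one, as parts are nonincreasing. A fraction with
  denominator 0 is thus 0/0, which has the value 0 in HOL, so that comparisons with it hold.\<close>

definition lecture_hall_cond :: "nat \<Rightarrow> nat \<Rightarrow> nat \<Rightarrow> (nat \<Rightarrow> nat) \<Rightarrow> nat \<Rightarrow> bool" where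
  "lecture_hall_cond c m n l k \<longleftrightarrow>
     (let p0 = rat_of_nat (part l (k * m + c));
          p1 = rat_of_nat (part l (k * m + m));
          p2 = rat_of_nat (part l ((k + 1) * m + c));
          q = rat_of_nat n - 2 * rat_of_nat k
      in fraction_convention p0 q \<and> fraction_convention p1 (q - 1) \<and>
         fraction_convention p2 (q - 2) \<and>
         p0 / q \<ge> p1 / (q - 1) \<and> p1 / (q - 1) \<ge> p2 / (q - 2))"

definition L_set :: "nat \<Rightarrow> nat \<Rightarrow> nat \<Rightarrow> (nat \<Rightarrow> nat) set" where
  "L_set c m n = {l \<in> Dc_set c m.
     plength l \<le> ((n + 1) div 2) * (m - 2) + n \<and>
     (\<forall>k < (n + 1) div 2. lecture_hall_cond c m n l k)}"

text \<open>Formal power series in \<open>q\<close> and \<open>z\<close> over the rationals are series in \<open>q\<close> whose coefficients are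
  series in \<open>z\<close>. The metric on the outer \<open>fps\<close> makes \<open>has_sum\<close> the \<open>q\<close>-adic (coefficientwise in
  \<open>q\<close>) formal sum of a family. Division by a series whose \<open>q\<close>-constant coefficient is 1 is
  multiplication by its inverse.\<close>

abbreviation q_var :: "rat fps fps" where
  "q_var \<equiv> fps_X"

abbreviation z_var :: "rat fps fps" where
  "z_var \<equiv> fps_const fps_X"

end

theory Submission
  imports Defs
begin

text \<open>Members of \<open>L_set c m n\<close> are constant on the blocks of \<open>c\<close> and \<open>m - c\<close> consecutive indices
  prescribed by \<open>s_entry\<close>, so they are lecture hall partitions \<open>x\<close> of length \<open>n\<close> in disguise. With
  \<open>O = x 1 + x 3 + \<dots>\<close> and \<open>A = (x 0 - x 1) + (x 2 - x 3) + \<dots>\<close> the weights become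
  \<open>psize = m * O + c * A\<close> and \<open>s = A\<close>.

  Given \<open>x\<close> of length \<open>n\<close> and \<open>k \<ge> 0\<close>, build \<open>y\<close> of length \<open>n + 1\<close>: its odd-indexed entries are the
  even-indexed entries of \<open>x\<close>; each odd-indexed entry of \<open>x\<close> is reflected in the interval that its two
  neighbours allow, which gives the later even-indexed entries of \<open>y\<close>; and \<open>k\<close> is the excess of \<open>y 0\<close>
  over its least admissible value. Since \<open>\<lceil>x (d + 1) / d\<rceil> + \<lfloor>x (d - 1) / d\<rfloor> = 2 * x\<close>, the sums of the end
  points telescope, so that \<open>O\<close> changes to \<open>O + A\<close> and \<open>A\<close> to \<open>A + k\<close>. Hence the generating function
  for the weights \<open>z ^ A * q ^ (p * O + r * A)\<close> gains the factor \<open>1 / (1 - z * q ^ r)\<close> while \<open>r\<close> is replaced by \<open>p + r\<close>.\<close>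

section \<open>Weight generating functions\<close>

text \<open>Coefficientwise reading of a formal sum. Finiteness of the fibres of \<open>v\<close> is
  built in, since a HOL sum over an infinite set is 0 and would make the equation
  meaningless.\<close>

definition has_gf :: "'a set \<Rightarrow> ('a \<Rightarrow> nat) \<Rightarrow> ('a \<Rightarrow> nat) \<Rightarrow> rat fps fps \<Rightarrow> bool" where
  "has_gf A u v S \<longleftrightarrow>
     (\<forall>k. finite {a \<in> A. v a = k} \<and> fps_nth S k = (\<Sum>a | a \<in> A \<and> v a = k. fps_X ^ u a))"

lemma nth_z_power_q_power:
  "fps_nth (z_var ^ a * q_var ^ b) k = (if k = b then fps_X ^ a else 0)"
  by (simp add: fps_const_power fps_X_power_nth)

text \<open>The coefficient at \<open>k\<close> is already exact for every finite subset of
  \<open>A\<close> that contains the fibre of weight \<open>k\<close>, so each coefficient is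
  eventually constant.\<close>

lemma has_gf_imp_has_sum:
  assumes "has_gf A u v S"
  shows "((\<lambda>a. z_var ^ u a * q_var ^ v a) has_sum S) A"
  unfolding has_sum_def
proof (rule tendsto_fpsI)
  fix k
  let ?F = "{a \<in> A. v a = k}"
  have fin: "finite ?F" and S: "fps_nth S k = (\<Sum>a \<in> ?F. fps_X ^ u a)"
    using assms by (auto simp: has_gf_def)
  show "\<forall>\<^sub>F X in finite_subsets_at_top A.
      fps_nth (\<Sum>a\<in>X. z_var ^ u a * q_var ^ v a) k = fps_nth S k"
    unfolding eventually_finite_subsets_at_top
  proof (intro exI[of _ ?F] conjI allI impI fin)
    fix Y assume Y: "finite Y \<and> ?F \<subseteq> Y \<and> Y \<subseteq> A"
    have "fps_nth (\<Sum>a\<in>Y. z_var ^ u a * q_var ^ v a) k = (\<Sum>a\<in>Y. if k = v a then fps_X ^ u a else 0)"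
      by (simp only: fps_sum_nth nth_z_power_q_power)
    also have "\<dots> = (\<Sum>a\<in>?F. fps_X ^ u a)"
      using Y by (intro sum.mono_neutral_cong_right) auto
    finally show "fps_nth (\<Sum>a\<in>Y. z_var ^ u a * q_var ^ v a) k = fps_nth S k"
      using S by simp
  qed auto
qed

lemma has_gf_bij_betw:
  assumes f: "bij_betw f A B"
    and u: "\<And>a. a \<in> A \<Longrightarrow> u' (f a) = u a" and v: "\<And>a. a \<in> A \<Longrightarrow> v' (f a) = v a"
    and gf: "has_gf A u v S"
  shows "has_gf B u' v' S"
  unfolding has_gf_def
proof
  fix k
  have bij: "bij_betw f {a \<in> A. v a = k} {b \<in> B. v' b = k}"
    using f v by (force simp: bij_betw_def inj_on_def image_iff)
  have "(\<Sum>b | b \<in> B \<and> v' b = k. fps_X ^ u' b :: rat fps) = (\<Sum>a | a \<in> A \<and> v a = k. fps_X ^ u' (f a))"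
    using sum.reindex_bij_betw[OF bij, of "\<lambda>b. fps_X ^ u' b :: rat fps"] by simp
  also have "\<dots> = (\<Sum>a | a \<in> A \<and> v a = k. fps_X ^ u a)"
    using u by (intro sum.cong) auto
  finally show "finite {b \<in> B. v' b = k} \<and> fps_nth S k = (\<Sum>b | b \<in> B \<and> v' b = k. fps_X ^ u' b)"
    using bij_betw_finite[OF bij] gf by (auto simp: has_gf_def)
qed

lemma has_gf_singleton: "u a = 0 \<Longrightarrow> v a = 0 \<Longrightarrow> has_gf {a} u v 1"
  by (auto simp: has_gf_def cong: conj_cong)

text \<open>The coefficient ring \<open>rat fps\<close> is not a field. Constant coefficient 1 makes
  the subdegree 0, so division is multiplication by the unique inverse.\<close>

lemma one_divide_fps_unique:
  fixes P S :: "rat fps fps"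
  assumes "fps_nth P 0 = 1" "S * P = 1"
  shows "1 / P = S"
proof -
  have "subdegree P = 0"
    using assms(1) by (simp add: subdegree_eq_0_iff)
  hence "1 / P = inverse P"
    by (simp add: fps_divide_unit')
  moreover have "P * inverse P = 1"
    unfolding fps_inverse_def using assms(1) by (intro fps_right_inverse) simp
  hence "inverse P = S * P * inverse P"
    using assms(2) by simp
  hence "inverse P = S"
    using \<open>P * inverse P = 1\<close> by (simp add: mult.assoc)
  ultimately show ?thesis by simp
qed

text \<open>Geometric series: pairs with \<open>j = 0\<close> contribute \<open>1 / P\<close>, and
  lowering a positive \<open>j\<close> by one takes off a factor \<open>z_var * q_var ^ p\<close>.
  Hence the total satisfies \<open>S = 1 / P + S * (z_var * q_var ^ p)\<close>.\<close>

lemma has_gf_times_nat: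
  assumes gf: "has_gf A u v (1 / P)" and P: "fps_nth P 0 = 1" and p: "p > 0"
  shows "has_gf (UNIV \<times> A) (\<lambda>(j, a). j + u a) (\<lambda>(j, a). j * p + v a)
           (1 / (P * (1 - z_var * q_var ^ p)))"
proof -
  define F where "F k = {(j, a). a \<in> A \<and> j * p + v a = k}" for k
  define S where "S = Abs_fps (\<lambda>k. \<Sum>(j, a) \<in> F k. fps_X ^ (j + u a) :: rat fps)"
  have fin: "finite (F k)" for k
  proof (rule finite_subset)
    have "j \<le> j * p" for j using p by simp
    hence "j \<le> k" if "j * p + x = k" for j x
      using that le_add1 order_trans by metis
    thus "F k \<subseteq> {..k} \<times> (\<Union>i\<le>k. {a \<in> A. v a = i})"
      by (auto simp: F_def)
    show "finite ({..k} \<times> (\<Union>i\<le>k. {a \<in> A. v a = i}))"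
      using gf by (auto simp: has_gf_def)
  qed
  have 0: "fps_nth (1 / P) k = (\<Sum>(j, a) \<in> F k. if j = 0 then fps_X ^ (j + u a) else 0)" for k
  proof -
    have "(\<Sum>(j, a) \<in> F k. if j = 0 then fps_X ^ (j + u a) else 0) =
        (\<Sum>(j, a) \<in> Pair (0::nat) ` {a \<in> A. v a = k}. fps_X ^ u a :: rat fps)"
      using fin[of k] by (intro sum.mono_neutral_cong_right) (auto simp: F_def image_iff)
    also have "\<dots> = (\<Sum>a | a \<in> A \<and> v a = k. fps_X ^ u a)"
      by (subst sum.reindex) (auto simp: inj_on_def)
    finally show ?thesis
      using gf by (simp add: has_gf_def)
  qed
  have 1: "fps_nth (S * (z_var * q_var ^ p)) k =
      (\<Sum>(j, a) \<in> F k. if j = 0 then 0 else fps_X ^ (j + u a))" for k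
  proof -
    have "(\<Sum>(j, a) \<in> F k. if j = 0 then 0 else fps_X ^ (j + u a)) =
      (\<Sum>(j, a) \<in> {x \<in> F k. fst x \<noteq> 0}. fps_X ^ (j + u a) :: rat fps)"
      using fin[of k] by (intro sum.mono_neutral_cong_right) (auto split: if_splits)
    also have "\<dots> = (if k < p then 0 else fps_X * (\<Sum>(j, a) \<in> F (k - p). fps_X ^ (j + u a)))"
    proof (cases "k < p")
      case True
      have empty: "{x \<in> F k. fst x \<noteq> 0} = {}"
      proof -
        have "\<not> j * p + x = k" if "j \<noteq> 0" for j x
        proof -
          have "p \<le> j * p" using that by simp
          thus ?thesis using True by linarith
        qed
        thus ?thesis by (auto simp: F_def)
      qed
      show ?thesis using True by (simp only: empty sum.empty if_True)
    next
      case False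
      have "{x \<in> F k. fst x \<noteq> 0} = map_prod Suc id ` F (k - p)"
      proof -
        have "(j, a) \<in> map_prod Suc id ` F (k - p)" if "(j, a) \<in> F k" "j \<noteq> 0" for j a
          using that by (cases j) (auto simp: F_def image_iff intro!: bexI[of _ "(j - 1, a)"])
        thus ?thesis using False by (auto simp: F_def)
      qed
      moreover have "inj_on (map_prod Suc id) (F (k - p))"
        by (auto simp: inj_on_def)
      ultimately show ?thesis
        using False by (simp add: sum.reindex sum_distrib_left case_prod_unfold)
    qed
    also have "\<dots> = fps_nth (S * (z_var * q_var ^ p)) k"
    proof -
      have "S * (z_var * q_var ^ p) = z_var * S * q_var ^ p" by (simp add: mult_ac)
      hence "fps_nth (S * (z_var * q_var ^ p)) k = (if k < p then 0 else fps_X * fps_nth S (k - p))"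
        by (simp only: fps_X_power_mult_right_nth fps_mult_left_const_nth)
      thus ?thesis by (simp add: S_def)
    qed
    finally show ?thesis ..
  qed
  have S: "S * (1 - z_var * q_var ^ p) = 1 / P"
  proof (rule fps_ext)
    fix k
    have "fps_nth (1 / P) k + fps_nth (S * (z_var * q_var ^ p)) k = fps_nth S k"
      unfolding 0 1 sum.distrib[symmetric] by (auto simp: S_def intro!: sum.cong)
    thus "fps_nth (S * (1 - z_var * q_var ^ p)) k = fps_nth (1 / P) k"
      by (simp only: right_diff_distrib fps_sub_nth mult_1_right diff_eq_eq)
  qed
  have "P * inverse P = 1"
    unfolding fps_inverse_def using P by (intro fps_right_inverse) simp
  moreover from this have "1 / P = inverse P"
    using P by (intro one_divide_fps_unique) (simp_all add: mult.commute)
  ultimately have "1 / (P * (1 - z_var * q_var ^ p)) = S"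
    using S P p by (intro one_divide_fps_unique) (simp_all add: mult_ac)
  moreover have "{x \<in> UNIV \<times> A. (case x of (j, a) \<Rightarrow> j * p + v a) = k} = F k" for k
    by (auto simp: F_def)
  ultimately show ?thesis
    using fin unfolding has_gf_def by (simp add: S_def case_prod_unfold)
qed

section \<open>Partitions with parts in a given set\<close>

definition partitions_into :: "nat set \<Rightarrow> (nat \<Rightarrow> nat) set" where
  "partitions_into P = {l \<in> partitions. \<forall>i. l i \<noteq> 0 \<longrightarrow> l i \<in> P}"

definition prepend :: "nat \<Rightarrow> nat \<Rightarrow> (nat \<Rightarrow> nat) \<Rightarrow> nat \<Rightarrow> nat" where
  "prepend k p l i = (if i < k then p else l (i - k))"

lemma partitionsD: "l \<in> partitions \<Longrightarrow> i \<le> j \<Longrightarrow> l j \<le> l i"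
  by (auto simp: partitions_def antimono_def)

lemma finite_support_partition: "l \<in> partitions \<Longrightarrow> finite {i. l i \<noteq> 0}"
  by (auto simp: partitions_def)

lemma partition_bounded_support:
  assumes "l \<in> partitions"
  obtains B where "\<And>i. i \<ge> B \<Longrightarrow> l i = 0"
proof -
  obtain B where "{i. l i \<noteq> 0} \<subseteq> {..<B}"
    using finite_support_partition[OF assms] by (auto simp only: finite_nat_iff_bounded)
  hence "l i = 0" if "i \<ge> B" for i
    using that by (auto simp: subset_iff not_less)
  thus ?thesis using that by blast
qed

lemma prepend_support:
  assumes "p > 0"
  shows "{i. prepend k p l i \<noteq> 0} = {..<k} \<union> (\<lambda>i. i + k) ` {i. l i \<noteq> 0}"
proof -
  have "i \<in> (\<lambda>i. i + k) ` {i. l i \<noteq> 0}" if "\<not> i < k" "l (i - k) \<noteq> 0" for i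
    using that by (intro image_eqI[of _ _ "i - k"]) auto
  thus ?thesis
    using assms by (auto simp: prepend_def split: if_splits)
qed

lemma plength_prepend:
  assumes "p > 0" "l \<in> partitions"
  shows "plength (prepend k p l) = k + plength l"
  unfolding plength_def prepend_support[OF assms(1)]
  using finite_support_partition[OF assms(2)] by (subst card_Un_disjoint) (auto simp: card_image inj_on_def)

lemma psize_prepend:
  assumes "p > 0" "l \<in> partitions"
  shows "psize (prepend k p l) = k * p + psize l"
  unfolding psize_def prepend_support[OF assms(1)]
  using finite_support_partition[OF assms(2)]
  by (subst sum.union_disjoint) (auto simp: sum.reindex inj_on_def prepend_def)

lemma partitions_into_less:
  assumes "l \<in> partitions_into P" "\<And>x. x \<in> P \<Longrightarrow> x < p" "p > 0"
  shows "l i < p"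
  using assms by (cases "l i = 0") (auto simp: partitions_into_def)

text \<open>The number is the multiplicity of \<open>p\<close>: elements of \<open>P\<close> are
  smaller, so the copies of \<open>p\<close> form an initial run that ends at the first other
  entry.\<close>

lemma bij_betw_prepend:
  assumes less: "\<And>x. x \<in> P \<Longrightarrow> x < p" and p: "p > 0"
  shows "bij_betw (\<lambda>(k, l). prepend k p l) (UNIV \<times> partitions_into P) (partitions_into (insert p P))"
proof -
  note lt = partitions_into_less[OF _ less p]
  have inj: "inj_on (\<lambda>(k, l). prepend k p l) (UNIV \<times> partitions_into P)"
  proof (rule inj_onI, clarify)
    fix k l k' l'
    assume l: "l \<in> partitions_into P" and l': "l' \<in> partitions_into P"
      and eq: "prepend k p l = prepend k' p l'"
    have eqi: "prepend k p l i = prepend k' p l' i" for i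
      by (simp add: eq)
    have k: "k = k'"
      using eqi[of k] eqi[of k'] lt[OF l, of 0] lt[OF l', of 0]
      by (cases k k' rule: linorder_cases) (simp_all add: prepend_def)
    moreover have "l i = l' i" for i
      using eqi[of "i + k"] k by (simp add: prepend_def)
    ultimately show "k = k' \<and> l = l'"
      by auto
  qed
  have into: "prepend k p l \<in> partitions_into (insert p P)" if l: "l \<in> partitions_into P" for k l
  proof -
    have lp: "l \<in> partitions" using l by (simp add: partitions_into_def)
    have "antimono (prepend k p l)"
      using lt[OF l] partitionsD[OF lp]
      by (auto simp: antimono_def prepend_def intro: less_imp_le)
    thus ?thesis
      using l lp prepend_support[OF p, of k l]
      by (auto simp: partitions_into_def partitions_def prepend_def)
  qed
  have onto: "l \<in> (\<lambda>(k, l). prepend k p l) ` (UNIV \<times> partitions_into P)"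
    if l: "l \<in> partitions_into (insert p P)" for l
  proof -
    have lp: "l \<in> partitions" using l by (simp add: partitions_into_def)
    obtain B where "l B = 0" using partition_bounded_support[OF lp] by blast
    hence ex: "\<exists>i. l i \<noteq> p" using p by (intro exI[of _ B]) simp
    define k where "k = (LEAST i. l i \<noteq> p)"
    have k: "l k \<noteq> p" unfolding k_def using ex by (rule LeastI_ex)
    have below: "l i = p" if "i < k" for i using that not_less_Least k_def by blast
    have "l k < p" using k l less p by (cases "l k = 0") (auto simp: partitions_into_def)
    hence above: "l (i + k) < p" for i
      using partitionsD[OF lp, of k "i + k"] by simp
    define l' where "l' i = l (i + k)" for i
    have "l' \<in> partitions_into P"
    proof -
      have "(\<lambda>i. i + k) ` {i. l' i \<noteq> 0} \<subseteq> {i. l i \<noteq> 0}" by (auto simp: l'_def)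
      hence "finite {i. l' i \<noteq> 0}"
        using finite_support_partition[OF lp] by (metis finite_subset finite_imageD inj_on_add')
      moreover have "antimono l'" using partitionsD[OF lp] by (auto simp: antimono_def l'_def)
      moreover have "l' i \<in> P" if "l' i \<noteq> 0" for i
        using that l above[of i] by (auto simp: partitions_into_def l'_def)
      ultimately show ?thesis by (simp add: partitions_into_def partitions_def)
    qed
    moreover have "prepend k p l' = l"
    proof
      fix i
      show "prepend k p l' i = l i" by (cases "i < k") (simp_all add: prepend_def l'_def below)
    qed
    ultimately show ?thesis
      by (intro image_eqI[of _ _ "(k, l')"]) simp_all
  qed
  show ?thesis
    using inj by (rule bij_betw_imageI) (use into onto in fast)
qed

lemma nth_prod_0_eq_1:
  assumes "\<And>j. j \<in> J \<Longrightarrow> f j > 0"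
  shows "fps_nth (\<Prod>j\<in>J. 1 - z_var * q_var ^ f j) 0 = 1"
  using assms by (induction J rule: infinite_finite_induct) auto

text \<open>Strict monotonicity makes \<open>f n\<close> exceed all earlier part sizes, so its
  multiplicity is the free natural number of \<open>has_gf_times_nat\<close>.\<close>

lemma has_gf_partitions_into:
  fixes f :: "nat \<Rightarrow> nat"
  assumes pos: "\<And>j. f j > 0" and mono: "strict_mono f"
  shows "has_gf (partitions_into (f ` {..<n})) plength psize (1 / (\<Prod>j<n. 1 - z_var * q_var ^ f j))"
proof (induction n)
  case 0
  have "partitions_into {} = {\<lambda>_. 0}"
    by (auto simp: partitions_into_def partitions_def antimono_def)
  moreover have "1 / (1 :: rat fps fps) = 1"
    by (rule one_divide_fps_unique) auto
  ultimately show ?case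
    by (auto simp: plength_def psize_def intro: has_gf_singleton)
next
  case (Suc n)
  have 0: "fps_nth (\<Prod>j<n. 1 - z_var * q_var ^ f j) 0 = 1"
    using pos by (intro nth_prod_0_eq_1)
  have ins: "f ` {..<Suc n} = insert (f n) (f ` {..<n})"
    by (simp add: lessThan_Suc)
  have bij: "bij_betw (\<lambda>(k, l). prepend k (f n) l) (UNIV \<times> partitions_into (f ` {..<n}))
      (partitions_into (f ` {..<Suc n}))"
    unfolding ins using mono pos by (intro bij_betw_prepend) (auto simp: strict_mono_less)
  show ?case
    unfolding prod.lessThan_Suc
    by (rule has_gf_bij_betw[OF bij _ _ has_gf_times_nat[OF Suc 0 pos]])
       (auto simp: plength_prepend psize_prepend pos partitions_into_def)
qed

section \<open>The case of \<open>O_set\<close>\<close>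

lemma O_set_eq_partitions_into:
  assumes c: "1 \<le> c" "c < m" and n: "n \<ge> 1"
  shows "O_set c m n = partitions_into ((\<lambda>j. j * m + c) ` {..<n})"
proof -
  have "x \<in> (\<lambda>j. j * m + c) ` {..<n} \<longleftrightarrow> [x = c] (mod m) \<and> x < n * m" for x
  proof
    assume "[x = c] (mod m) \<and> x < n * m"
    hence "x = x div m * m + c" "x div m < n"
      using c by (auto simp: cong_def less_mult_imp_div_less)
    thus "x \<in> (\<lambda>j. j * m + c) ` {..<n}" by blast
  next
    assume "x \<in> (\<lambda>j. j * m + c) ` {..<n}"
    then obtain j where j: "j < n" "x = j * m + c" by auto
    have "Suc j * m \<le> n * m" using j by (intro mult_right_mono) auto
    thus "[x = c] (mod m) \<and> x < n * m"
      using j c by (auto simp: cong_def)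
  qed
  \<comment> \<open>Bounding the largest part bounds all parts; for the empty partition the strict
    bound reads \<open>0 < n * m\<close>, which uses \<open>n \<ge> 1\<close>.\<close>
  moreover have "l 0 < n * m \<longleftrightarrow> (\<forall>i. l i \<noteq> 0 \<longrightarrow> l i < n * m)" if "l \<in> partitions" for l
    using partitionsD[OF that, of 0] n c by (cases "l 0 = 0"; fastforce intro: le_less_trans)
  ultimately show ?thesis
    by (auto simp: O_set_def partitions_into_def part_def)
qed

lemma plength_nondvd_eq_plength:
  assumes "l \<in> O_set c m n" "1 \<le> c" "c < m"
  shows "plength_nondvd m l = plength l"
proof -
  have "\<not> m dvd l i" if "l i \<noteq> 0" for i
    using assms that by (auto simp: O_set_def cong_def dvd_eq_mod_eq_0)
  thus ?thesis
    unfolding plength_nondvd_def plength_def by (intro arg_cong[of _ _ card]) auto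
qed

section \<open>Lecture hall partitions\<close>

definition cdiv :: "nat \<Rightarrow> nat \<Rightarrow> nat" where
  "cdiv x d = (x + d - 1) div d"

lemma cdiv_0_left [simp]: "cdiv 0 d = 0"
  by (cases d) (auto simp: cdiv_def)

lemma cdiv_0_right [simp]: "cdiv x 0 = 0"
  by (simp add: cdiv_def)

lemma cdiv_Suc_0 [simp]: "cdiv x (Suc 0) = x"
  by (simp add: cdiv_def)

lemma cdiv_le_iff:
  assumes "d > 0"
  shows "cdiv x d \<le> z \<longleftrightarrow> x \<le> z * d"
proof -
  have "cdiv x d \<le> z \<longleftrightarrow> (x + d - 1) div d < Suc z"
    by (simp add: cdiv_def less_Suc_eq_le)
  also have "\<dots> \<longleftrightarrow> x + d - 1 < Suc z * d"
    using assms by (rule div_less_iff_less_mult)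
  also have "\<dots> \<longleftrightarrow> x \<le> z * d"
    using assms by auto
  finally show ?thesis .
qed

lemma cdiv_le: "cdiv x d \<le> x"
  by (cases "d = 0") (auto simp: cdiv_le_iff)

text \<open>With \<open>x = y + z\<close> both sides say \<open>y \<le> z * d\<close>. The right
  side bounds \<open>y\<close> from above in terms of \<open>x\<close>.\<close>

lemma mult_le_iff_cdiv_upper: "y * Suc d \<le> x * d \<longleftrightarrow> y + cdiv x (Suc d) \<le> x"
proof (cases "y \<le> x")
  case True
  then obtain z where "x = y + z" using le_Suc_ex by blast
  thus ?thesis by (auto simp: cdiv_le_iff algebra_simps)
next
  case False
  hence "x * d \<le> y * d" "y > 0" by auto
  hence "\<not> y * Suc d \<le> x * d" unfolding mult_Suc_right by linarith
  thus ?thesis using False by linarith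
qed

text \<open>The same inequality as a lower bound for \<open>x\<close> in terms of \<open>y\<close>.
  At \<open>d = 0\<close> it would fail, since \<open>cdiv y 0 = 0\<close> loses the condition
  \<open>y = 0\<close>.\<close>

lemma mult_le_iff_cdiv_lower:
  assumes "d > 0"
  shows "y * Suc d \<le> x * d \<longleftrightarrow> y + cdiv y d \<le> x"
proof (cases "y \<le> x")
  case True
  then obtain z where "x = y + z" using le_Suc_ex by blast
  thus ?thesis using assms by (auto simp: cdiv_le_iff algebra_simps)
next
  case False
  hence "\<not> y * Suc d \<le> x * d"
    unfolding mult_le_iff_cdiv_upper by linarith
  thus ?thesis using False by linarith
qed

text \<open>The classical chain \<open>x 0 / n \<ge> x 1 / (n - 1) \<ge> ... \<ge> x (n - 1) / 1
  \<ge> 0\<close>, cross-multiplied to stay in the naturals.\<close>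

definition lecture_hall :: "nat \<Rightarrow> (nat \<Rightarrow> nat) set" where
  "lecture_hall n =
     {x. (\<forall>i<n. x (Suc i) * (n - i) \<le> x i * (n - Suc i)) \<and> (\<forall>i\<ge>n. x i = 0)}"

lemma lecture_hallI:
  assumes "\<And>i. i < n \<Longrightarrow>
      x (Suc i) + cdiv (x i) (n - i) \<le> x i \<or> x (Suc i) + cdiv (x (Suc i)) (n - Suc i) \<le> x i"
    and supp: "\<And>i. i \<ge> n \<Longrightarrow> x i = 0"
  shows "x \<in> lecture_hall n"
proof -
  have "x (Suc i) * (n - i) \<le> x i * (n - Suc i)" if i: "i < n" for i
  \<comment> \<open>Here the next denominator is 0 and the lower form says too little;
    \<open>x n = 0\<close> settles it.\<close>
  proof (cases "Suc i = n")
    case True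
    thus ?thesis by (simp add: supp)
  next
    case False
    with i obtain d where d: "n - i = Suc d" "n - Suc i = d" "d > 0"
      by (metis Suc_diff_Suc Suc_lessI zero_less_diff)
    show ?thesis
      using assms(1)[OF i] d mult_le_iff_cdiv_upper mult_le_iff_cdiv_lower by metis
  qed
  thus ?thesis by (simp add: lecture_hall_def supp)
qed

lemma lecture_hall_zero: "x \<in> lecture_hall n \<Longrightarrow> i \<ge> n \<Longrightarrow> x i = 0"
  by (simp add: lecture_hall_def)

lemma lecture_hall_upper:
  assumes "x \<in> lecture_hall n"
  shows "x (Suc i) + cdiv (x i) (n - i) \<le> x i"
proof (cases "i < n")
  case True
  then obtain d where d: "n - i = Suc d" "n - Suc i = d"
    by (metis Suc_diff_Suc)
  moreover have "x (Suc i) * (n - i) \<le> x i * (n - Suc i)"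
    using assms True by (simp add: lecture_hall_def)
  ultimately show ?thesis
    using mult_le_iff_cdiv_upper by metis
next
  case False
  thus ?thesis using lecture_hall_zero[OF assms] by simp
qed

lemma lecture_hall_lower:
  assumes "x \<in> lecture_hall n"
  shows "x (Suc i) + cdiv (x (Suc i)) (n - Suc i) \<le> x i"
proof (cases "Suc i < n")
  case True
  then obtain d where d: "n - i = Suc d" "n - Suc i = d" "d > 0"
    by (metis Suc_diff_Suc Suc_lessD zero_less_diff)
  moreover have "x (Suc i) * (n - i) \<le> x i * (n - Suc i)"
    using assms True by (simp add: lecture_hall_def)
  ultimately show ?thesis
    using mult_le_iff_cdiv_lower by metis
next
  case False
  thus ?thesis using lecture_hall_zero[OF assms] by simp
qed

lemma lecture_hall_0: "lecture_hall 0 = {\<lambda>_. 0}"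
  by (auto simp: lecture_hall_def)

text \<open>For \<open>x \<in> lecture_hall n\<close> the entry \<open>x (j + 1)\<close> ranges over the interval from
  \<open>x (j + 2) + cdiv (x (j + 2)) (n - (j + 2))\<close> to \<open>x j - cdiv (x j) (n - j)\<close>. Reflecting that interval
  is the only nontrivial ingredient of the passage from length \<open>n\<close> to length \<open>n + 1\<close>: there every
  entry moves up by one place, so the denominators \<open>n - j\<close>, and with them the interval, are unchanged.\<close>

definition reflect :: "nat \<Rightarrow> (nat \<Rightarrow> nat) \<Rightarrow> nat \<Rightarrow> nat" where
  "reflect n x j =
     (x j - cdiv (x j) (n - j)) + (x (j + 2) + cdiv (x (j + 2)) (n - (j + 2))) - x (j + 1)"

text \<open>Both forms of the inequality place \<open>x (j + 1)\<close> between the end points, so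
  the truncated subtractions in \<open>reflect\<close> are exact and the mirror image stays in the
  interval.\<close>

lemma reflect_bounds:
  assumes "x \<in> lecture_hall n"
  shows "reflect n x j + cdiv (x j) (n - j) \<le> x j"
    and "x (j + 2) + cdiv (x (j + 2)) (n - (j + 2)) \<le> reflect n x j"
    and "reflect n x j + x (j + 1) =
           (x j - cdiv (x j) (n - j)) + (x (j + 2) + cdiv (x (j + 2)) (n - (j + 2)))"
  using lecture_hall_upper[OF assms, of j] lecture_hall_lower[OF assms, of "j + 1"]
  by (simp_all add: reflect_def)

lemma reflect_eq_0:
  assumes "x \<in> lecture_hall n" "Suc j \<ge> n"
  shows "reflect n x j = 0"
proof -
  have "x j \<le> cdiv (x j) (n - j)"
  proof (cases "j \<ge> n")
    case True
    thus ?thesis using lecture_hall_zero[OF assms(1)] by simp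
  next
    case False
    hence "n - j = Suc 0" using assms(2) by simp
    thus ?thesis by simp
  qed
  thus ?thesis using reflect_bounds(1)[OF assms(1), of j] by simp
qed

section \<open>Bijection between lengths \<open>n\<close> and \<open>n + 1\<close>\<close>

definition raise :: "nat \<Rightarrow> nat \<Rightarrow> (nat \<Rightarrow> nat) \<Rightarrow> nat \<Rightarrow> nat" where
  "raise n k x j =
     (if j = 0 then k + x 0 + cdiv (x 0) n else if odd j then x (j - 1) else reflect n x (j - 2))"

definition lower :: "nat \<Rightarrow> (nat \<Rightarrow> nat) \<Rightarrow> nat \<Rightarrow> nat" where
  "lower n y j = (if even j then y (j + 1) else reflect (Suc n) y j)"

lemma nat_parity_cases:
  fixes i :: nat
  obtains "i = 0" | r where "i = 2 * r + 1" | r where "i = 2 * r + 2"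
proof -
  consider "i = 0" | "odd i" | "even i" "i > 0" by auto
  thus ?thesis
  proof cases
    case 3
    hence "i = 2 * (i div 2 - 1) + 2" by auto
    thus ?thesis using that by blast
  qed (use that in \<open>auto elim: oddE\<close>)
qed

text \<open>An even-indexed entry past 0 is a reflected one: the upper end of its interval gives the
  inequality with its predecessor, the lower end that with its successor.\<close>

lemma raise_mem:
  assumes x: "x \<in> lecture_hall n"
  shows "raise n k x \<in> lecture_hall (Suc n)"
proof (rule lecture_hallI)
  fix i :: nat
  consider "i = 0" | r where "i = 2 * r + 1" | r where "i = 2 * r + 2"
    by (rule nat_parity_cases[of i])
  thus "raise n k x (Suc i) + cdiv (raise n k x i) (Suc n - i) \<le> raise n k x i \<or>
      raise n k x (Suc i) + cdiv (raise n k x (Suc i)) (Suc n - Suc i) \<le> raise n k x i"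
  proof cases
    case 1
    thus ?thesis by (simp add: raise_def)
  next
    case 2
    thus ?thesis using reflect_bounds(1)[OF x, of "2 * r"] by (simp add: raise_def)
  next
    case 3
    thus ?thesis using reflect_bounds(2)[OF x, of "2 * r"] by (simp add: raise_def)
  qed
next
  fix i assume "i \<ge> Suc n"
  thus "raise n k x i = 0"
    using lecture_hall_zero[OF x, of "i - 1"] reflect_eq_0[OF x, of "i - 2"]
    by (auto simp: raise_def)
qed

lemma lower_mem:
  assumes y: "y \<in> lecture_hall (Suc n)"
  shows "lower n y \<in> lecture_hall n"
proof (rule lecture_hallI)
  fix i
  show "lower n y (Suc i) + cdiv (lower n y i) (n - i) \<le> lower n y i \<or>
      lower n y (Suc i) + cdiv (lower n y (Suc i)) (n - Suc i) \<le> lower n y i"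
    using reflect_bounds(1)[OF y, of "Suc i"] reflect_bounds(2)[OF y, of i]
    by (auto simp: lower_def)
next
  fix i assume "i \<ge> n"
  thus "lower n y i = 0"
    using lecture_hall_zero[OF y, of "i + 1"] reflect_eq_0[OF y, of i]
    by (auto simp: lower_def)
qed

lemma lower_raise:
  assumes x: "x \<in> lecture_hall n"
  shows "lower n (raise n k x) = x"
proof
  fix j
  show "lower n (raise n k x) j = x j"
  proof (cases "even j")
    case True
    thus ?thesis by (simp add: lower_def raise_def)
  next
    case False
    \<comment> \<open>Places and length both go up by one, so both reflections use the same interval
      and cancel.\<close>
    then obtain r where "j = 2 * r + 1" by (rule oddE)
    thus ?thesis
      using reflect_bounds(3)[OF x, of "2 * r"]
      by (simp add: lower_def reflect_def[of "Suc n"] raise_def)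
  qed
qed

lemma raise_lower:
  assumes y: "y \<in> lecture_hall (Suc n)"
  shows "raise n (y 0 - (y 1 + cdiv (y 1) n)) (lower n y) = y"
proof
  fix i :: nat
  consider "i = 0" | r where "i = 2 * r + 1" | r where "i = 2 * r + 2"
    by (rule nat_parity_cases[of i])
  thus "raise n (y 0 - (y 1 + cdiv (y 1) n)) (lower n y) i = y i"
  proof cases
    case 1
    thus ?thesis using lecture_hall_lower[OF y, of 0] by (simp add: raise_def lower_def)
  next
    case 2
    thus ?thesis by (simp add: raise_def lower_def)
  next
    case 3
    thus ?thesis
      using reflect_bounds(3)[OF y, of "2 * r + 1"]
      by (simp add: raise_def reflect_def[of n] lower_def)
  qed
qed

lemma bij_betw_raise:
  "bij_betw (\<lambda>(k, x). raise n k x) (UNIV \<times> lecture_hall n) (lecture_hall (Suc n))"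
proof (rule bij_betw_byWitness[where f' = "\<lambda>y. (y 0 - (y 1 + cdiv (y 1) n), lower n y)"])
  show "\<forall>a\<in>UNIV \<times> lecture_hall n.
      (\<lambda>y. (y 0 - (y 1 + cdiv (y 1) n), lower n y)) ((\<lambda>(k, x). raise n k x) a) = a"
    by (auto simp: lower_raise) (simp add: raise_def)
qed (use lower_mem raise_lower in \<open>auto simp: raise_mem\<close>)

section \<open>Weights under \<open>raise\<close> and the resulting product\<close>

definition odd_sum :: "nat \<Rightarrow> (nat \<Rightarrow> nat) \<Rightarrow> nat" where
  "odd_sum K x = (\<Sum>i<K. x (2 * i + 1))"

definition alt_sum :: "nat \<Rightarrow> (nat \<Rightarrow> nat) \<Rightarrow> nat" where
  "alt_sum K x = (\<Sum>i<K. x (2 * i) - x (2 * i + 1))"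

lemma lecture_hall_le: "x \<in> lecture_hall n \<Longrightarrow> x (Suc i) \<le> x i"
  using lecture_hall_upper[of x n i] by simp

lemma even_sum_eq:
  assumes "x \<in> lecture_hall n"
  shows "(\<Sum>i<K. x (2 * i)) = odd_sum K x + alt_sum K x"
  using lecture_hall_le[OF assms] by (auto simp: odd_sum_def alt_sum_def sum.distrib[symmetric])

lemma odd_sum_raise: "x \<in> lecture_hall n \<Longrightarrow> odd_sum K (raise n k x) = odd_sum K x + alt_sum K x"
  unfolding even_sum_eq[symmetric] by (simp add: odd_sum_def raise_def)

lemma alt_sum_raise:
  assumes x: "x \<in> lecture_hall n" and K: "n < K"
  shows "alt_sum K (raise n k x) = k + alt_sum K x"
proof -
  let ?y = "raise n k x"
  \<comment> \<open>The ceiling added with one reflected entry is subtracted with the next, so only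
    the last end point survives.\<close>
  have telescope: "(\<Sum>i<Suc J. ?y (2 * i)) + odd_sum J x =
      k + 2 * (\<Sum>i<J. x (2 * i)) + (x (2 * J) + cdiv (x (2 * J)) (n - 2 * J))" for J
  proof (induction J)
    case 0
    thus ?case by (simp add: raise_def odd_sum_def)
  next
    case (Suc J)
    have "?y (2 * Suc J) + x (2 * J + 1) = (x (2 * J) - cdiv (x (2 * J)) (n - 2 * J)) +
        (x (2 * Suc J) + cdiv (x (2 * Suc J)) (n - 2 * Suc J))"
      using reflect_bounds(3)[OF x, of "2 * J"] by (simp add: raise_def)
    with Suc cdiv_le[of "x (2 * J)" "n - 2 * J"] show ?case
      unfolding odd_sum_def sum.lessThan_Suc[of _ J] sum.lessThan_Suc[of _ "Suc J"] by simp
  qed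
  \<comment> \<open>\<open>n < K\<close> puts index \<open>2 * K\<close> past both supports, which
    removes the surviving end point and the extra summand.\<close>
  have "x (2 * K) = 0" "?y (2 * K) = 0"
    using K lecture_hall_zero[OF x] lecture_hall_zero[OF raise_mem[OF x]] by auto
  hence "(\<Sum>i<K. ?y (2 * i)) + odd_sum K x = k + 2 * (\<Sum>i<K. x (2 * i))"
    using telescope[of K] by simp
  thus ?thesis
    unfolding even_sum_eq[OF x] even_sum_eq[OF raise_mem[OF x]] odd_sum_raise[OF x] by simp
qed

text \<open>Under \<open>raise\<close> the weight \<open>p * O + r * A\<close> becomes
  \<open>p * O + (p + r) * A + r * k\<close>, so the induction varies \<open>r\<close>, and
  \<open>k\<close> is the free natural number. \<open>K\<close> stays fixed so that all lengths
  share the same weight functions.\<close>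

lemma has_gf_lecture_hall:
  assumes "n \<le> K" "r > 0"
  shows "has_gf (lecture_hall n) (alt_sum K) (\<lambda>x. p * odd_sum K x + r * alt_sum K x)
           (1 / (\<Prod>j<n. 1 - z_var * q_var ^ (j * p + r)))"
  using assms
proof (induction n arbitrary: r)
  case 0
  have "1 / (1 :: rat fps fps) = 1"
    by (rule one_divide_fps_unique) auto
  thus ?case
    by (auto simp: lecture_hall_0 alt_sum_def odd_sum_def intro: has_gf_singleton)
next
  case (Suc n)
  have IH: "has_gf (lecture_hall n) (alt_sum K) (\<lambda>x. p * odd_sum K x + (p + r) * alt_sum K x)
      (1 / (\<Prod>j<n. 1 - z_var * q_var ^ (j * p + (p + r))))"
    using Suc.prems by (intro Suc.IH) auto
  have 0: "fps_nth (\<Prod>j<n. 1 - z_var * q_var ^ (j * p + (p + r))) 0 = 1"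
    using Suc.prems by (intro nth_prod_0_eq_1) auto
  have "(\<Prod>j<Suc n. 1 - z_var * q_var ^ (j * p + r)) =
      (\<Prod>j<n. 1 - z_var * q_var ^ (j * p + (p + r))) * (1 - z_var * q_var ^ r)"
    unfolding prod.lessThan_Suc_shift by (simp add: algebra_simps)
  thus ?case
    by (simp only:) (rule has_gf_bij_betw[OF bij_betw_raise _ _ has_gf_times_nat[OF IH 0 Suc.prems(2)]],
       use Suc.prems in \<open>auto simp: odd_sum_raise alt_sum_raise algebra_simps\<close>)
qed

section \<open>Partitions that are constant on blocks\<close>

lemma lecture_hall_antimono:
  assumes "x \<in> lecture_hall n" "i \<le> j"
  shows "x j \<le> x i"
  using assms(2) by (induction rule: dec_induct) (use lecture_hall_le[OF assms(1)] order_trans in blast)+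

text \<open>A positive entry drops by at least \<open>cdiv (x i) (n - i) \<ge> 1\<close> at the next
  place.\<close>

lemma lecture_hall_less:
  assumes x: "x \<in> lecture_hall n" and "i < j" "x i > 0"
  shows "x j < x i"
proof -
  have "i < n"
    using assms lecture_hall_zero[OF x, of i] by (cases "i < n") auto
  hence "\<not> cdiv (x i) (n - i) \<le> 0"
    using assms(3) by (subst cdiv_le_iff) auto
  hence "x (Suc i) < x i"
    using lecture_hall_upper[OF x, of i] by simp
  thus ?thesis
    using lecture_hall_antimono[OF x, of "Suc i" j] assms(2) by simp
qed

lemma sum_lessThan_mult: "(\<Sum>i<K * m. f i) = (\<Sum>k<K. \<Sum>r<m. f (k * m + r))" for f :: "nat \<Rightarrow> nat"
proof -
  have "(\<Sum>i<K * m. f i) = (\<Sum>k<K. sum f {k * m..<k * m + m})"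
    by (rule sum.nat_group[symmetric])
  also have "\<dots> = (\<Sum>k<K. \<Sum>r<m. f (k * m + r))"
  proof (rule sum.cong)
    show "sum f {k * m..<k * m + m} = (\<Sum>r<m. f (k * m + r))" for k
      using sum.shift_bounds_nat_ivl[of f 0 "k * m" m] by (simp add: lessThan_atLeast0 add.commute)
  qed simp
  finally show ?thesis .
qed

lemma psize_eq_sum:
  assumes "\<And>i. i \<ge> B \<Longrightarrow> l i = 0"
  shows "psize l = (\<Sum>i<B. l i)"
proof -
  have "{i. l i \<noteq> 0} \<subseteq> {..<B}"
    using assms by (metis (mono_tags) lessThan_iff mem_Collect_eq not_le subsetI)
  thus ?thesis
    unfolding psize_def by (intro sum.mono_neutral_left) auto
qed

lemma s_entry_eq_sum:
  assumes l: "\<And>i. i \<ge> J \<Longrightarrow> l i = 0" and "m \<ge> 1" "i \<ge> 1"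
  shows "s_entry m i l = (\<Sum>j<J. part l (j * m + i) - part l (j * m + i + 1))"
  unfolding s_entry_def
proof (rule suminf_finite)
  fix j assume "j \<notin> {..<J}"
  moreover have "j \<le> j * m" using assms by simp
  ultimately have "J \<le> j * m" unfolding lessThan_iff not_less by (rule order_trans)
  hence "J \<le> j * m + i - 1" using assms(3) by simp
  thus "part l (j * m + i) - part l (j * m + i + 1) = 0" by (simp add: part_def l)
qed simp

lemma of_nat_divide_le_iff:
  assumes "u > 0" "v > 0"
  shows "rat_of_nat a / rat_of_nat u \<le> rat_of_nat b / rat_of_nat v \<longleftrightarrow> a * v \<le> b * u"
  using assms by (simp add: divide_simps flip: of_nat_mult)

text \<open>Block \<open>k\<close> of \<open>m\<close> indices holds \<open>c\<close> copies of
  \<open>x (2 * k)\<close>, then \<open>m - c\<close> copies of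
  \<open>x (2 * k + 1)\<close>.\<close>

definition spread :: "nat \<Rightarrow> nat \<Rightarrow> (nat \<Rightarrow> nat) \<Rightarrow> nat \<Rightarrow> nat" where
  "spread c m x i = x (2 * (i div m) + (if i mod m < c then 0 else 1))"

text \<open>Samples each run at its last position, which is exactly where
  \<open>lecture_hall_cond\<close> reads the partition.\<close>

definition collapse :: "nat \<Rightarrow> nat \<Rightarrow> (nat \<Rightarrow> nat) \<Rightarrow> nat \<Rightarrow> nat" where
  "collapse c m l j = part l ((j div 2) * m + (if even j then c else m))"

context
  fixes c m :: nat
  assumes c: "1 \<le> c" "c < m"
begin

lemma spread_block: "r < m \<Longrightarrow> spread c m x (k * m + r) = x (2 * k + (if r < c then 0 else 1))"
  by (simp add: spread_def)

lemma part_spread: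
  "1 \<le> i \<Longrightarrow> i \<le> m \<Longrightarrow> part (spread c m x) (k * m + i) = x (2 * k + (if i \<le> c then 0 else 1))"
  using spread_block[of "i - 1" x k] by (auto simp: part_def)

lemma part_spread_Suc:
  "i < m \<Longrightarrow> part (spread c m x) (k * m + i + 1) = x (2 * k + (if i < c then 0 else 1))"
  using spread_block[of i x k] by (simp add: part_def)

lemma collapse_spread: "collapse c m (spread c m x) = x"
proof
  fix j
  show "collapse c m (spread c m x) j = x j"
    using c by (cases "even j") (auto simp: collapse_def part_spread elim: evenE oddE)
qed

lemma spread_collapse:
  assumes "\<And>k i. 1 \<le> i \<Longrightarrow> i < m \<Longrightarrow> i \<noteq> c \<Longrightarrow> part l (k * m + i) = part l (k * m + i + 1)"
  shows "spread c m (collapse c m l) = l"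
proof
  fix i
  define k r where "k = i div m" and "r = i mod m"
  have i: "i = k * m + r" and r: "r < m" using c by (auto simp: k_def r_def)
  have step: "l (k * m + r) = l (k * m + Suc r)" if "Suc r < m" "Suc r \<noteq> c" for r
    using assms[of "Suc r" k] that by (simp add: part_def)
  show "spread c m (collapse c m l) i = l i"
  proof (cases "r < c")
    case True
    hence "r \<le> c - 1" by simp
    hence "l (k * m + r) = l (k * m + (c - 1))"
      by (induction rule: inc_induct) (use c step in auto)
    thus ?thesis using True r c by (simp add: i spread_block collapse_def part_def)
  next
    case False
    from r have "r \<le> m - 1" by simp
    hence "l (k * m + r) = l (k * m + (m - 1))" using False
      by (induction rule: inc_induct) (use step in auto)
    thus ?thesis using False r c by (simp add: i spread_block collapse_def part_def)
  qed
qed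

section \<open>Statistics of spread partitions\<close>

lemma spread_eq_0:
  assumes "x \<in> lecture_hall n" "K \<ge> n" "i \<ge> K * m"
  shows "spread c m x i = 0"
proof -
  have "K \<le> i div m" using assms c by (simp add: less_eq_div_iff_mult_less_eq)
  thus ?thesis using assms(2) unfolding spread_def by (intro lecture_hall_zero[OF assms(1)]) auto
qed

text \<open>Neighbours can differ only where a run ends. In a block this is position
  \<open>c\<close>, with drop \<open>x (2 * k) - x (2 * k + 1)\<close>, or position
  \<open>m\<close>, which no index \<open>i < m\<close> counts.\<close>

lemma s_entry_spread:
  assumes x: "x \<in> lecture_hall n" and K: "n \<le> K" and i: "1 \<le> i" "i < m"
  shows "s_entry m i (spread c m x) = (if i = c then alt_sum K x else 0)"
proof -
  have "s_entry m i (spread c m x) =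
      (\<Sum>j<K * m. part (spread c m x) (j * m + i) - part (spread c m x) (j * m + i + 1))"
    using spread_eq_0[OF x K] i by (intro s_entry_eq_sum) auto
  also have "\<dots> = (\<Sum>j<K * m. if i = c then x (2 * j) - x (2 * j + 1) else 0)"
    unfolding part_spread_Suc[OF i(2)] part_spread[OF i(1) less_imp_le[OF i(2)]]
    by (intro sum.cong) auto
  also have "\<dots> = (if i = c then alt_sum K x else 0)"
  proof -
    have "(\<Sum>j<K * m. x (2 * j) - x (2 * j + 1)) = alt_sum K x"
      unfolding alt_sum_def using c K lecture_hall_zero[OF x]
      by (intro sum.mono_neutral_right) (auto simp: less_le_trans)
    thus ?thesis by simp
  qed
  finally show ?thesis .
qed

lemma s_total_spread:
  assumes "x \<in> lecture_hall n" "n \<le> K"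
  shows "s_total m (spread c m x) = alt_sum K x"
proof -
  have "s_total m (spread c m x) = (\<Sum>i = 1..m - 1. if i = c then alt_sum K x else 0)"
    unfolding s_total_def using assms c by (intro sum.cong s_entry_spread) auto
  thus ?thesis using c by simp
qed

lemma psize_spread:
  assumes x: "x \<in> lecture_hall n" and K: "n \<le> K"
  shows "psize (spread c m x) = m * odd_sum K x + c * alt_sum K x"
proof -
  have block: "(\<Sum>r<m. spread c m x (k * m + r)) = c * x (2 * k) + (m - c) * x (2 * k + 1)" for k
  proof -
    have "{..<m} = {..<c} \<union> {c..<m}" using c by auto
    hence "(\<Sum>r<m. spread c m x (k * m + r)) =
        (\<Sum>r<c. spread c m x (k * m + r)) + (\<Sum>r=c..<m. spread c m x (k * m + r))"
      by (simp add: sum.union_disjoint ivl_disj_int)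
    also have "(\<Sum>r<c. spread c m x (k * m + r)) = (\<Sum>r<c. x (2 * k))"
      using c by (intro sum.cong) (auto simp: spread_block)
    also have "(\<Sum>r=c..<m. spread c m x (k * m + r)) = (\<Sum>r=c..<m. x (2 * k + 1))"
      by (intro sum.cong) (auto simp: spread_block)
    finally show ?thesis by simp
  qed
  have "psize (spread c m x) = (\<Sum>k<K. c * x (2 * k) + (m - c) * x (2 * k + 1))"
    unfolding block[symmetric] sum_lessThan_mult[symmetric]
    using spread_eq_0[OF x K] by (intro psize_eq_sum)
  also have "\<dots> = c * (\<Sum>k<K. x (2 * k)) + (m - c) * odd_sum K x"
    by (simp add: sum.distrib sum_distrib_left odd_sum_def)
  also have "\<dots> = c * alt_sum K x + (c + (m - c)) * odd_sum K x"
    unfolding even_sum_eq[OF x] by (simp add: algebra_simps)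
  finally show ?thesis using c by simp
qed

lemma spread_mem_partitions:
  assumes x: "x \<in> lecture_hall n"
  shows "spread c m x \<in> partitions"
proof -
  have "spread c m x j \<le> spread c m x i" if "i \<le> j" for i j
    unfolding spread_def
  proof (rule lecture_hall_antimono[OF x])
    have "i mod m \<le> j mod m" if "i div m = j div m"
      using \<open>i \<le> j\<close> that by (metis add_le_cancel_left div_mult_mod_eq)
    thus "2 * (i div m) + (if i mod m < c then 0 else 1) \<le> 2 * (j div m) + (if j mod m < c then 0 else 1)"
      using div_le_mono[OF that, of m] by (cases "i div m = j div m") auto
  qed
  moreover have "{i. spread c m x i \<noteq> 0} \<subseteq> {..<n * m}"
    using spread_eq_0[OF x order_refl] by (metis (mono_tags) lessThan_iff mem_Collect_eq not_le subsetI)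
  ultimately show ?thesis
    by (auto simp: partitions_def antimono_def intro: finite_subset)
qed

text \<open>Positive entries of \<open>x\<close> are distinct, so a value fills at most one run, of
  length \<open>c\<close> or \<open>m - c\<close>.\<close>

lemma card_spread_fibre:
  assumes x: "x \<in> lecture_hall n" and p: "p > 0"
  shows "card {i. spread c m x i = p} \<le> m - 1"
proof (cases "\<exists>j. x j = p")
  case True
  then obtain j where j: "x j = p" by blast
  have "i = j" if "x i = p" for i
    using that j p lecture_hall_less[OF x, of i j] lecture_hall_less[OF x, of j i]
    by (cases i j rule: linorder_cases) auto
  hence *: "{i. spread c m x i = p} \<subseteq> {i. 2 * (i div m) + (if i mod m < c then 0 else 1) = j}"
    by (auto simp: spread_def)
  show ?thesis
  proof (cases "even j")
    case True
    have "{i. spread c m x i = p} \<subseteq> (\<lambda>r. j div 2 * m + r) ` {..<c}"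
    proof
      fix i assume "i \<in> {i. spread c m x i = p}"
      with * True have "i div m = j div 2" "i mod m < c" by (auto split: if_splits)
      thus "i \<in> (\<lambda>r. j div 2 * m + r) ` {..<c}"
        by (intro image_eqI[of _ _ "i mod m"]) (auto, metis div_mult_mod_eq)
    qed
    hence "card {i. spread c m x i = p} \<le> card {..<c}"
      by (meson card_image_le card_mono finite_imageI finite_lessThan le_trans)
    thus ?thesis using c by simp
  next
    case False
    have "{i. spread c m x i = p} \<subseteq> (\<lambda>r. j div 2 * m + r) ` {c..<m}"
    proof
      fix i assume "i \<in> {i. spread c m x i = p}"
      with * False have "i div m = j div 2" "\<not> i mod m < c" by (auto split: if_splits)
      thus "i \<in> (\<lambda>r. j div 2 * m + r) ` {c..<m}"
        using c by (intro image_eqI[of _ _ "i mod m"]) (auto, metis div_mult_mod_eq)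
    qed
    hence "card {i. spread c m x i = p} \<le> card {c..<m}"
      by (meson card_image_le card_mono finite_imageI finite_atLeastLessThan le_trans)
    thus ?thesis using c by simp
  qed
next
  case False
  hence "{i. spread c m x i = p} = {}" by (auto simp: spread_def)
  thus ?thesis by simp
qed

lemma spread_mem_Dc_set:
  assumes x: "x \<in> lecture_hall n"
  shows "spread c m x \<in> Dc_set c m"
proof -
  have D: "spread c m x \<in> D_set m"
    using spread_mem_partitions[OF x] card_spread_fibre[OF x] by (simp add: D_set_def)
  show ?thesis
  proof (cases "x 0 = 0")
    case True
    hence "x j = 0" for j
      using lecture_hall_antimono[OF x, of 0 j] by simp
    thus ?thesis using D by (simp add: Dc_set_def psize_def spread_def)
  next
    case False
    hence "n \<noteq> 0" using lecture_hall_zero[OF x, of 0] by auto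
    have "0 < x (2 * 0) - x (2 * 0 + 1)"
      using lecture_hall_less[OF x, of 0 1] False by simp
    also have "\<dots> \<le> alt_sum n x"
      unfolding alt_sum_def using \<open>n \<noteq> 0\<close> by (intro member_le_sum) auto
    finally have "alt_sum n x > 0" .
    moreover have "\<forall>i\<in>{1..m - 1}. s_entry m i (spread c m x) = (if i = c then alt_sum n x else 0)"
      using s_entry_spread[OF x order_refl] c by auto
    ultimately show ?thesis
      using D unfolding Dc_set_def by blast
  qed
qed

lemma plength_spread:
  assumes x: "x \<in> lecture_hall n"
  shows "plength (spread c m x) \<le> ((n + 1) div 2) * (m - 2) + n"
proof -
  let ?B = "((n + 1) div 2) * (m - 2) + n"
  have "i < ?B" if "spread c m x i \<noteq> 0" for i
  proof -
    define k r where "k = i div m" and "r = i mod m"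
    have i: "i = k * m + r" and r: "r < m" using c by (auto simp: k_def r_def)
    have lt: "2 * k + (if r < c then 0 else 1) < n"
      using that lecture_hall_zero[OF x] unfolding i spread_block[OF r] by (meson not_less)
    obtain d where d: "m = d + 2" using c le_Suc_ex[of 2 m] by auto
    define h where "h = (n + 1) div 2"
    have h: "n + 1 = 2 * h \<or> n = 2 * h" unfolding h_def by presburger
    hence "k < h" using lt by auto
    hence kh: "Suc k * d \<le> h * d" by (intro mult_right_mono) auto
    have "k * d + 2 * k + r < h * d + n"
    \<comment> \<open>The bound is \<open>h * m\<close> for even \<open>n\<close> and
      \<open>h * m - 1\<close> for odd \<open>n\<close>. In the odd case the second run of the last
      block is \<open>x n = 0\<close>, so there \<open>r < c \<le> m - 1\<close>.\<close>
    proof (cases "Suc k = h \<and> n + 1 = 2 * h")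
      case True
      thus ?thesis using lt kh c d by (auto split: if_splits)
    next
      case False
      hence "2 * k + 2 \<le> n" using h \<open>k < h\<close> by auto
      thus ?thesis using kh r d by simp
    qed
    thus ?thesis by (simp add: i d h_def algebra_simps)
  qed
  hence "{i. spread c m x i \<noteq> 0} \<subseteq> {..<?B}" by auto
  thus ?thesis
    unfolding plength_def using card_mono[OF finite_lessThan] by fastforce
qed

section \<open>Clearing denominators in \<open>lecture_hall_cond\<close>\<close>

lemma lecture_hall_cond_iff:
  assumes "2 * k < n"
  shows "lecture_hall_cond c m n l k \<longleftrightarrow>
    part l (k * m + m) * (n - 2 * k) \<le> part l (k * m + c) * (n - 2 * k - 1) \<and>
    (2 * k + 1 < n \<longrightarrow>
      part l ((k + 1) * m + c) * (n - 2 * k - 1) \<le> part l (k * m + m) * (n - 2 * k - 2))"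
proof -
  define q where "q = n - 2 * k"
  have q: "rat_of_nat n - 2 * rat_of_nat k = rat_of_nat q"
    using assms by (simp add: q_def of_nat_diff)
  have "lecture_hall_cond c m n l k \<longleftrightarrow> p1 * q \<le> p0 * (q - 1) \<and> (1 < q \<longrightarrow> p2 * (q - 1) \<le> p1 * (q - 2))"
    if "p0 = part l (k * m + c)" "p1 = part l (k * m + m)" "p2 = part l ((k + 1) * m + c)" for p0 p1 p2
  proof -
    \<comment> \<open>For \<open>q = 1\<close> the denominators are 1, 0 and -1: the convention
      gives \<open>p1 = 0\<close>, and the last comparison holds automatically. For
      \<open>q = 2\<close> it gives \<open>p2 = 0\<close>. Beyond that all denominators are
      positive.\<close>
    consider "q = 1" | "q = 2" | "q > 2" using assms by (fastforce simp: q_def)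
    thus ?thesis
    proof cases
      case 1
      thus ?thesis
        unfolding lecture_hall_cond_def Let_def q that[symmetric]
        by (auto simp: fraction_convention_def)
    next
      case 2
      have "p1 * 2 \<le> p0 \<longleftrightarrow> rat_of_nat p1 * 2 \<le> rat_of_nat p0"
        by (metis of_nat_le_iff of_nat_mult of_nat_numeral)
      thus ?thesis using 2
        unfolding lecture_hall_cond_def Let_def q that[symmetric]
        by (auto simp: fraction_convention_def)
    next
      case 3
      have q1: "rat_of_nat q - 1 = rat_of_nat (q - 1)" "rat_of_nat q - 2 = rat_of_nat (q - 2)"
        using 3 by (simp_all add: of_nat_diff)
      have pos: "rat_of_nat q > 0" "rat_of_nat (q - 1) > 0" "rat_of_nat (q - 2) > 0"
        using 3 by simp_all
      have "rat_of_nat p1 / rat_of_nat (q - 1) \<le> rat_of_nat p0 / rat_of_nat q \<longleftrightarrow> p1 * q \<le> p0 * (q - 1)"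
        using 3 by (intro of_nat_divide_le_iff) auto
      moreover have "rat_of_nat p2 / rat_of_nat (q - 2) \<le> rat_of_nat p1 / rat_of_nat (q - 1)
          \<longleftrightarrow> p2 * (q - 1) \<le> p1 * (q - 2)"
        using 3 by (intro of_nat_divide_le_iff) auto
      ultimately show ?thesis using 3 pos
        unfolding lecture_hall_cond_def Let_def q q1 that[symmetric]
        by (auto simp: fraction_convention_def)
    qed
  qed
  from this[OF refl refl refl] show ?thesis
    using assms by (auto simp: q_def)
qed

text \<open>Condition \<open>k\<close> bundles the inequalities at \<open>2 * k\<close> and
  \<open>2 * k + 1\<close>; for odd \<open>n\<close> the last one has only the first.\<close>

lemma all_lecture_hall_cond_iff:
  "(\<forall>k < (n + 1) div 2. lecture_hall_cond c m n l k) \<longleftrightarrow>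
     (\<forall>i<n. collapse c m l (Suc i) * (n - i) \<le> collapse c m l i * (n - Suc i))"
    (is "?L \<longleftrightarrow> (\<forall>i<n. ?P i)")
proof -
  have cond: "lecture_hall_cond c m n l k \<longleftrightarrow> ?P (2 * k) \<and> (2 * k + 1 < n \<longrightarrow> ?P (2 * k + 1))"
    if "k < (n + 1) div 2" for k
  proof -
    have "2 * k < n" using that by linarith
    from lecture_hall_cond_iff[OF this] show ?thesis
      by (simp add: collapse_def)
  qed
  show ?thesis
  proof
    assume L: ?L
    show "\<forall>i<n. ?P i"
    proof (intro allI impI)
      fix i assume i: "i < n"
      hence k: "i div 2 < (n + 1) div 2" by linarith
      with L cond have "?P (2 * (i div 2)) \<and> (2 * (i div 2) + 1 < n \<longrightarrow> ?P (2 * (i div 2) + 1))" by blast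
      thus "?P i" using i by (cases "even i") (auto elim!: evenE oddE)
    qed
  next
    assume "\<forall>i<n. ?P i"
    thus ?L using cond by auto
  qed
qed

lemma spread_mem_L_set:
  assumes x: "x \<in> lecture_hall n"
  shows "spread c m x \<in> L_set c m n"
  using x spread_mem_Dc_set[OF x] plength_spread[OF x]
  unfolding L_set_def mem_Collect_eq all_lecture_hall_cond_iff collapse_spread
  by (simp add: lecture_hall_def)

section \<open>From \<open>L_set\<close> back to lecture hall partitions\<close>

lemma s_entry_eq_0:
  assumes "l \<in> Dc_set c m" "1 \<le> i" "i < m" "i \<noteq> c"
  shows "s_entry m i l = 0"
proof (cases "psize l = 0")
  case True
  have "l \<in> partitions" using assms(1) by (simp add: Dc_set_def D_set_def)
  hence "l i = 0" for i
    using True finite_support_partition[of l] by (auto simp: psize_def)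
  thus ?thesis by (simp add: s_entry_def part_def)
next
  case False
  thus ?thesis using assms by (auto simp: Dc_set_def)
qed

text \<open>A vanishing sum of naturals has vanishing terms; as parts never increase, each zero
  difference is an equality of neighbours.\<close>

lemma spread_collapse_Dc_set:
  assumes l: "l \<in> Dc_set c m"
  shows "spread c m (collapse c m l) = l"
proof (rule spread_collapse)
  fix k i assume i: "1 \<le> i" "i < m" "i \<noteq> c"
  have lp: "l \<in> partitions" using l by (simp add: Dc_set_def D_set_def)
  obtain B where B: "\<And>i. i \<ge> B \<Longrightarrow> l i = 0"
    using partition_bounded_support[OF lp] by blast
  \<comment> \<open>\<open>max B (Suc k)\<close> clears the support and keeps the term at
    \<open>k\<close> in the sum.\<close>
  have "s_entry m i l = (\<Sum>j<max B (Suc k). part l (j * m + i) - part l (j * m + i + 1))"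
    using B i by (intro s_entry_eq_sum) auto
  hence "part l (k * m + i) - part l (k * m + i + 1) = 0"
    using s_entry_eq_0[OF l i] by (simp add: sum_eq_0_iff)
  moreover have "part l (k * m + i + 1) \<le> part l (k * m + i)"
    unfolding part_def by (rule partitionsD[OF lp]) simp
  ultimately show "part l (k * m + i) = part l (k * m + i + 1)" by simp
qed

lemma collapse_mem_lecture_hall:
  assumes l: "l \<in> L_set c m n" and n: "n \<ge> 1"
  shows "collapse c m l \<in> lecture_hall n"
proof -
  let ?x = "collapse c m l"
  have lp: "l \<in> partitions" using l by (simp add: L_set_def Dc_set_def D_set_def)
  have cond: "?x (Suc i) * (n - i) \<le> ?x i * (n - Suc i)" if "i < n" for i
    using l that all_lecture_hall_cond_iff[of n l] by (simp add: L_set_def)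
  have mono: "?x (Suc i) \<le> ?x i" for i
    unfolding collapse_def part_def using c
    by (intro partitionsD[OF lp]) (cases "even i"; auto elim!: evenE oddE)
  \<comment> \<open>At \<open>i = n - 1\<close> the right side has the factor 0; monotonicity
    carries the zero onwards.\<close>
  have zero: "?x n = 0" using cond[of "n - 1"] n by simp
  have "?x i = 0" if "i \<ge> n" for i
    using that
  proof (induction i rule: dec_induct)
    case (step i)
    thus ?case using mono[of i] by simp
  qed (rule zero)
  thus ?thesis using cond by (simp add: lecture_hall_def)
qed

lemma bij_betw_spread:
  assumes "n \<ge> 1"
  shows "bij_betw (spread c m) (lecture_hall n) (L_set c m n)"
proof (rule bij_betw_byWitness[where f' = "collapse c m"])
  show "\<forall>l\<in>L_set c m n. spread c m (collapse c m l) = l"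
    using spread_collapse_Dc_set by (simp add: L_set_def)
qed (use collapse_spread spread_mem_L_set collapse_mem_lecture_hall assms in auto)

end

theorem theorem3p1:
  fixes m c n :: nat
  assumes "m \<ge> 2" and "1 \<le> c" and "c \<le> m - 1" and "n \<ge> 1"
  shows "((\<lambda>l. z_var ^ plength_nondvd m l * q_var ^ psize l) has_sum
            1 / (\<Prod>j<n. 1 - z_var * q_var ^ (j * m + c))) (O_set c m n) \<and>
         ((\<lambda>l. z_var ^ s_total m l * q_var ^ psize l) has_sum
            1 / (\<Prod>j<n. 1 - z_var * q_var ^ (j * m + c))) (L_set c m n)"
proof
  have c: "1 \<le> c" "c < m" using assms by auto
  have "has_gf (O_set c m n) plength psize (1 / (\<Prod>j<n. 1 - z_var * q_var ^ (j * m + c)))"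
    unfolding O_set_eq_partitions_into[OF c assms(4)]
    using c by (intro has_gf_partitions_into) (auto simp: strict_mono_def)
  hence "((\<lambda>l. z_var ^ plength l * q_var ^ psize l) has_sum
      1 / (\<Prod>j<n. 1 - z_var * q_var ^ (j * m + c))) (O_set c m n)"
    by (rule has_gf_imp_has_sum)
  thus "((\<lambda>l. z_var ^ plength_nondvd m l * q_var ^ psize l) has_sum
      1 / (\<Prod>j<n. 1 - z_var * q_var ^ (j * m + c))) (O_set c m n)"
    by (subst has_sum_cong) (auto simp: plength_nondvd_eq_plength[OF _ c])
next
  have c: "1 \<le> c" "c < m" using assms by auto
  show "((\<lambda>l. z_var ^ s_total m l * q_var ^ psize l) has_sum
      1 / (\<Prod>j<n. 1 - z_var * q_var ^ (j * m + c))) (L_set c m n)"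
    using has_gf_lecture_hall[of n n c m] c
    by (intro has_gf_imp_has_sum has_gf_bij_betw[OF bij_betw_spread[OF c assms(4)]])
       (auto simp: s_total_spread psize_spread)
qed

end
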